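(* $Q_{U(\emptyset,5)} \geq \frac{3}{2}$.
   Context: For a nonzero integer $N$, $\mathrm{rad}(N)$ denotes the largest square-free positive divisor of $N$. For $a = (a_1,\ldots,a_n) \in \mathbb{Z}^n$ with all $a_i \neq 0$, the quality of $a$ is $q(a) = \frac{\log(\max\{|a_1|,\ldots,|a_n|\})}{\log \mathrm{rad}(a_1 \cdots a_n)}$. For a set $A$ of such $n$-tuples, $Q_A$ denotes the limit superior of $q(a)$ over $a \in A$ (i.e. $\inf_{S \subseteq A \text{ finite}} \sup_{a \in A \setminus S} q(a)$). $U(\emptyset,5)$ is the set of all $(a_1,\ldots,a_5) \in \mathbb{Z}^5$ such that: (i) $\gcd(a_i,a_j) = 1$ for all $1 \leq i < j \leq 5$; (ii) $a_1 + \cdots + a_5 = 0$; (iii) there are no $b_1,\ldots,b_5 \in \{-1,0,1\}$ and indices $i,j$ with $b_i = 0$, $b_j = 1$ and $\sum_{k=1}^5 b_k a_k = 0$. *)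

theory Defs
  imports
    "HOL-Library.Extended_Real"
    "HOL-Computational_Algebra.Squarefree"
begin

definition rad :: "int \<Rightarrow> int" where
  "rad N = Max {d. d > 0 \<and> squarefree d \<and> d dvd N}"

text \<open>
  A tuple \<open>(a\<^sub>1, \<dots>, a\<^sub>n)\<close> of integers is a list of length \<open>n\<close>; entry \<open>a\<^sub>i\<close> is \<open>a ! (i - 1)\<close>.
\<close>

definition quality :: "int list \<Rightarrow> real" where
  "quality a =
     ln (real_of_int (Max (abs ` set a))) / ln (real_of_int (rad (prod_list a)))"

text \<open>
  The infimum and supremum are taken in the extended reals, so that the limit superior
  is \<open>-\<infinity>\<close> on a finite set and may be \<open>\<infinity>\<close> on an infinite one.
\<close>

definition limsup_quality :: "int list set \<Rightarrow> ereal" where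
  "limsup_quality A =
     (INF S\<in>{S. S \<subseteq> A \<and> finite S}. SUP a\<in>A - S. ereal (quality a))"

definition U_empty :: "nat \<Rightarrow> int list set" where
  "U_empty n =
     {a. length a = n \<and>
         (\<forall>i j. i < j \<and> j < n \<longrightarrow> gcd (a ! i) (a ! j) = 1) \<and>
         (\<Sum>k<n. a ! k) = 0 \<and>
         \<not> (\<exists>b. length b = n \<and> set b \<subseteq> {-1, 0, 1} \<and>
                (\<exists>i<n. \<exists>j<n. b ! i = 0 \<and> b ! j = 1) \<and>
                (\<Sum>k<n. b ! k * a ! k) = 0)}"

text \<open>
  A zero entry would violate the subsum condition (take \<open>b\<close> to be a unit vector), so
  \<^const>\<open>quality\<close> is only evaluated on tuples with nonzero entries.
\<close>

lemma U_empty_nonzero: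
  assumes "a \<in> U_empty n" "n \<ge> 2" "i < n"
  shows "a ! i \<noteq> 0"
proof
  assume 0: "a ! i = 0"
  define b :: "int list" where "b = (replicate n 0)[i := 1]"
  obtain j where j: "j < n" "j \<noteq> i"
    using assms(2) by (metis One_nat_def Suc_1 Suc_le_lessD less_trans zero_less_one zero_neq_one)
  have "length b = n" by (simp add: b_def)
  moreover have "set b \<subseteq> {-1, 0, 1}"
    using set_update_subset_insert[of "replicate n (0::int)" i 1]
    by (auto simp: b_def)
  moreover have "b ! j = 0" "b ! i = 1" using j assms(3) by (auto simp: b_def)
  moreover have "(\<Sum>k<n. b ! k * a ! k) = 0"
    using 0 assms(3) by (intro sum.neutral) (auto simp: b_def nth_list_update)
  ultimately show False
    using assms j unfolding U_empty_def by blast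
qed

end

theory Submission
  imports Defs "HOL-Real_Asymp.Real_Asymp"
begin

text \<open>
  For \<open>x = y - 1\<close>, the identity \<open>(x + 1)\<^sup>3 - (x - 1)\<^sup>3 - 6x\<^sup>2 - 7 + 5 = 0\<close> gives five numbers
  of sum zero. If \<open>y = x + 1\<close> is a power of 13, the radical of their product is \<open>O(y\<^sup>2)\<close>, whereas
  their maximum is \<open>y\<^sup>3\<close>; hence the quality tends to \<open>3/2\<close>. The constant 2 is split as \<open>7 - 5\<close>
  to leave only one even entry, and the exponents are restricted to \<open>1\<close> modulo \<open>12\<close>, so that
  \<open>y \<equiv> 13\<close> modulo \<open>420\<close>, which makes the entries pairwise coprime. A vanishing combination with
  coefficients in \<open>{-1, 0, 1}\<close> must have equal coefficients, by comparing orders of magnitude.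
\<close>

text \<open>Compare multiplicities prime by prime: a prime factor of \<open>d\<close> occurs exactly
  once in \<open>d\<close>, and it divides \<open>R\<close> because it divides a power of
  \<open>R\<close>.\<close>

lemma squarefree_dvd_powerD:
  fixes d R :: "'a :: factorial_semiring"
  assumes "squarefree d" "d dvd R ^ m"
  shows "d dvd R"
proof (cases "R = 0")
  case False
  have "d \<noteq> 0" using assms(1) by auto
  then show ?thesis
  proof (rule multiplicity_le_imp_dvd)
    fix p :: 'a assume p: "prime p"
    show "multiplicity p d \<le> multiplicity p R"
    proof (cases "p dvd d")
      case True
      with assms(2) p have "p dvd R"
        by (meson dvd_trans prime_dvd_power)
      with p False have "multiplicity p R \<ge> 1"
        by (intro multiplicity_geI) auto
      moreover have "multiplicity p d \<le> 1"
        using assms(1) p \<open>d \<noteq> 0\<close> squarefree_factorial_semiring'' by blast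
      ultimately show ?thesis by simp
    qed (simp add: not_dvd_imp_multiplicity_0)
  qed
qed simp

text \<open>These bounds avoid factoring \<open>N\<close>. Each competitor in the maximum is
  squarefree and so divides \<open>R\<close>; the prime \<open>p\<close> keeps \<open>rad N\<close>
  above 1, hence its logarithm positive.\<close>

lemma rad_bounds:
  assumes "N \<noteq> 0" "N dvd R ^ m" "R > 0" "prime p" "p dvd N"
  shows "p \<le> rad N" "rad N \<le> R"
proof -
  let ?D = "{d. d > 0 \<and> squarefree d \<and> d dvd N}"
  have "finite ?D"
    by (rule finite_subset[OF _ finite_divisors_int[OF assms(1)]]) auto
  moreover have p: "p \<in> ?D"
    using assms squarefree_prime prime_gt_0_int by auto
  ultimately show "p \<le> rad N"
    unfolding rad_def by (rule Max_ge)
  have "d \<le> R" if "d \<in> ?D" for d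
    using that assms squarefree_dvd_powerD[of d R m] by (auto intro: zdvd_imp_le dvd_trans)
  with \<open>finite ?D\<close> p show "rad N \<le> R"
    unfolding rad_def by (subst Max_le_iff) auto
qed

definition cubic_tuple :: "int \<Rightarrow> int list" where
  "cubic_tuple y = [y ^ 3, - ((y - 2) ^ 3), - 6 * (y - 1) ^ 2, - 7, 5]"

lemma cubic_tuple_pairwise_coprime:
  fixes y :: int
  assumes "y mod 420 = 13" "i < j" "j < 5"
  shows "coprime (cubic_tuple y ! i) (cubic_tuple y ! j)"
proof -
  obtain q where q: "y = 13 + 420 * q"
    using assms(1) by (metis mult_div_mod_eq add.commute)
  have bez: "coprime a b" if "u * a + v * b = 1" for a b u v :: int
    by (rule coprimeI) (use that in \<open>metis dvd_add dvd_mult\<close>)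
  \<comment> \<open>Half of \<open>(y - 1) * (y - 2) - y * (y - 3) = 2\<close>, with integer
    coefficients since \<open>y\<close> is odd.\<close>
  have 1: "coprime y (y - 2)"
    by (rule bez[of "- 5 - 210 * q" _ "6 + 210 * q"]) (simp add: q algebra_simps)
  have 2: "coprime y 6"
    by (rule bez[of 1 _ "- 2 - 70 * q"]) (simp add: q algebra_simps)
  have 3: "coprime y (y - 1)"
    by (rule bez[of 1 _ "- 1"]) simp
  have 4: "coprime y 7"
    by (rule bez[of "- 1" _ "2 + 60 * q"]) (simp add: q algebra_simps)
  have 5: "coprime y 5"
    by (rule bez[of "2" _ "- 5 - 168 * q"]) (simp add: q algebra_simps)
  have 6: "coprime (y - 2) 6"
    by (rule bez[of "- 1" _ "2 + 70 * q"]) (simp add: q algebra_simps)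
  have 7: "coprime (y - 2) (y - 1)"
    by (rule bez[of "- 1" _ 1]) simp
  have 8: "coprime (y - 2) 7"
    by (rule bez[of "2" _ "- 3 - 120 * q"]) (simp add: q algebra_simps)
  have 9: "coprime (y - 2) 5"
    by (rule bez[of "1" _ "- 2 - 84 * q"]) (simp add: q algebra_simps)
  have 10: "coprime (y - 1) 7"
    by (rule bez[of "3" _ "- 5 - 180 * q"]) (simp add: q algebra_simps)
  have 11: "coprime (y - 1) 5"
    by (rule bez[of "- 2" _ "5 + 168 * q"]) (simp add: q algebra_simps)
  have 12: "coprime (6::int) 7" "coprime (6::int) 5" "coprime (7::int) 5"
    by (rule bez[of "- 1" _ 1], simp, rule bez[of 1 _ "- 1"], simp, rule bez[of "- 2" _ 3], simp)
  note facts = 1 2 3 4 5 6 7 8 9 10 11 12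
  have "i \<in> {0,1,2,3,4}" "j \<in> {0,1,2,3,4}" using assms(2,3) by auto
  with assms(2) facts show ?thesis
    by (auto simp: cubic_tuple_def)
qed

lemma cubic_tuple_relation_constant:
  fixes y b0 b1 b2 b3 b4 :: int
  assumes "y \<ge> 13"
    and b: "b0 \<in> {-1,0,1}" "b1 \<in> {-1,0,1}" "b2 \<in> {-1,0,1}" "b3 \<in> {-1,0,1}" "b4 \<in> {-1,0,1}"
    and rel: "b0 * y ^ 3 - b1 * (y - 2) ^ 3 - b2 * (6 * (y - 1) ^ 2) - b3 * 7 + b4 * 5 = 0"
  shows "b0 = b1 \<and> b1 = b2 \<and> b2 = b3 \<and> b3 = b4"
proof -
  define x where "x = y - 1"
  have x: "x \<ge> 12" using assms(1) by (simp add: x_def)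
  have y: "y = x + 1" by (simp add: x_def)
  \<comment> \<open>Centring at \<open>x\<close> makes the two cubes share their odd part
    \<open>x ^ 3 + 3 * x\<close> and have opposite even parts.\<close>
  have r: "(b0 - b1) * (x ^ 3 + 3 * x) + (b0 + b1) * (3 * x ^ 2 + 1) - b2 * (6 * x ^ 2) - b3 * 7 + b4 * 5 = 0"
    using rel unfolding y by (simp add: algebra_simps power2_eq_square power3_eq_cube)
  have x2: "12 * x \<le> x ^ 2" "144 \<le> x ^ 2"
    using x mult_mono[of 12 x x x] mult_mono[of 12 x 12 x] by (auto simp: power2_eq_square)
  have x3: "12 * x ^ 2 \<le> x ^ 3"
    using x mult_right_mono[of 12 x "x * x"] by (simp add: power2_eq_square power3_eq_cube)
  \<comment> \<open>If \<open>b0 \<noteq> b1\<close>, the cubic term is at least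
    \<open>12 * x ^ 2 + 3 * x\<close>, while the rest is at most \<open>9 * x ^ 2 + 13\<close> in
    absolute value. So \<open>b0 = b1\<close>, leaving \<open>6 * (b0 - b2) * x ^ 2\<close> against
    constants of size at most 14. Hence \<open>b0 = b2\<close>, and
    \<open>2 * b0 = 7 * b3 - 5 * b4\<close> forces equality for coefficients in
    \<open>{-1,0,1}\<close>.\<close>
  show ?thesis
    using b r x x2 x3 by (auto simp: algebra_simps)
qed

lemma cubic_tuple_in_U_empty:
  assumes "y mod 420 = 13" "y \<ge> 13"
  shows "cubic_tuple y \<in> U_empty 5"
proof -
  have s: "(\<Sum>k<5. f k) = f 0 + f 1 + f 2 + f 3 + f 4" for f :: "nat \<Rightarrow> int"
    by (simp add: eval_nat_numeral)
  have "b ! i = b ! j" if "length b = 5" "set b \<subseteq> {-1,0,1}" "i < 5" "j < 5"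
      "(\<Sum>k<5. b ! k * cubic_tuple y ! k) = 0" for b i j
  proof -
    have m: "b ! k \<in> {-1,0,1}" if "k < 5" for k
      using that \<open>length b = 5\<close> \<open>set b \<subseteq> _\<close> nth_mem[of k b] by (metis subsetD)
    have "b ! 0 = b ! 1 \<and> b ! 1 = b ! 2 \<and> b ! 2 = b ! 3 \<and> b ! 3 = b ! 4"
      by (rule cubic_tuple_relation_constant[OF assms(2)]; (rule m)?)
        (use that(5) in \<open>simp_all add: s cubic_tuple_def\<close>)
    moreover have "i \<in> {0,1,2,3,4}" "j \<in> {0,1,2,3,4}" using that by auto
    ultimately show ?thesis by auto
  qed
  then have "\<not> (\<exists>b. length b = 5 \<and> set b \<subseteq> {-1, 0, 1} \<and>
      (\<exists>i<5. \<exists>j<5. b ! i = 0 \<and> b ! j = 1) \<and> (\<Sum>k<5. b ! k * cubic_tuple y ! k) = 0)"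
    by (metis zero_neq_one)
  moreover have "(\<Sum>k<5. cubic_tuple y ! k) = 0"
    by (simp add: s cubic_tuple_def power2_eq_square power3_eq_cube algebra_simps)
  ultimately show ?thesis
    using cubic_tuple_pairwise_coprime[OF assms(1)]
    unfolding U_empty_def coprime_iff_gcd_eq_1 by (simp add: cubic_tuple_def)
qed

lemma quality_cubic_tuple_ge:
  fixes k :: nat
  assumes "k > 0"
  shows "quality (cubic_tuple (13 ^ k)) \<ge> 3 * real k * ln 13 / (2 * real k * ln 13 + ln 2730)"
proof -
  define y :: int where "y = 13 ^ k"
  have y: "y \<ge> 13" using assms self_le_power[of "13::int" k] by (simp add: y_def)
  define N where "N = prod_list (cubic_tuple y)"
  \<comment> \<open>Dropping exponents from the product leaves
    \<open>13 * 210 * (y - 1) * (y - 2)\<close>, where 13 stands for \<open>y ^ 3\<close> and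
    \<open>210 = 6 * 7 * 5\<close>.\<close>
  define R where "R = 2730 * (y - 1) * (y - 2)"
  have N: "N = y ^ 3 * ((y - 2) ^ 3 * ((y - 1) ^ 2 * - 210))"
    by (simp add: N_def cubic_tuple_def)
  have "N \<noteq> 0" using y by (simp add: N)
  \<comment> \<open>The exponent \<open>3 * k + 6\<close> serves all factors at once:
    \<open>y ^ 3\<close> needs \<open>3 * k\<close>, the others at most 3.\<close>
  have "y ^ 3 dvd 13 ^ (3 * k + 6)"
    unfolding y_def by (simp add: power_mult[symmetric] mult.commute le_imp_power_dvd)
  moreover have "(y - 2) ^ 3 dvd (y - 2) ^ (3 * k + 6)" "(y - 1) ^ 2 dvd (y - 1) ^ (3 * k + 6)"
    by (auto intro: le_imp_power_dvd)
  moreover have "- 210 dvd (210::int) ^ (3 * k + 6)" by simp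
  ultimately have "N dvd 13 ^ (3 * k + 6) * ((y - 2) ^ (3 * k + 6) * ((y - 1) ^ (3 * k + 6) * 210 ^ (3 * k + 6)))"
    unfolding N by (intro mult_dvd_mono)
  also have "\<dots> = R ^ (3 * k + 6)"
    by (simp add: R_def power_mult_distrib[symmetric] mult_ac)
  finally have "N dvd R ^ (3 * k + 6)" .
  moreover have "R > 0" using y by (simp add: R_def)
  moreover have "prime (2::int)" "2 dvd N" by (simp_all add: N)
  ultimately have rad: "2 \<le> rad N" "rad N \<le> R"
    using rad_bounds \<open>N \<noteq> 0\<close> by blast+
  have "R \<le> 2730 * y * y"
    unfolding R_def using y by (intro mult_mono) auto
  with rad have "real_of_int (rad N) \<le> real_of_int (2730 * y * y)" by linarith
  also have "\<dots> = 2730 * 13 ^ k * 13 ^ k" by (simp add: y_def)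
  finally have "ln (rad N) \<le> ln (2730 * 13 ^ k * 13 ^ k :: real)"
    using rad(1) by simp
  also have "\<dots> = 2 * real k * ln 13 + ln 2730"
    by (simp add: ln_mult ln_realpow)
  finally have D: "ln (rad N) \<le> 2 * real k * ln 13 + ln 2730" .
  have D0: "ln (rad N) > 0" using rad(1) by simp
  have "13 ^ (3 * k) \<le> Max (abs ` set (cubic_tuple y))"
    by (rule Max_ge) (auto simp: cubic_tuple_def y_def power_mult[symmetric] mult.commute)
  then have "real_of_int (13 ^ (3 * k)) \<le> real_of_int (Max (abs ` set (cubic_tuple y)))"
    by linarith
  then have "ln (13 ^ (3 * k) :: real) \<le> ln (real_of_int (Max (abs ` set (cubic_tuple y))))"
    by (intro ln_mono) auto
  then have "3 * real k * ln 13 \<le> ln (real_of_int (Max (abs ` set (cubic_tuple y))))"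
    by (simp add: ln_realpow)
  moreover have "0 \<le> 3 * real k * ln 13" by simp
  ultimately show ?thesis
    using D D0 unfolding quality_def y_def[symmetric] N_def[symmetric]
    by (intro frac_le) linarith+
qed

text \<open>By injectivity, a finite \<open>S\<close> removes only finitely many terms
  \<open>t n\<close>; the supremum over the remaining set bounds \<open>f n\<close> for all large
  \<open>n\<close>, hence also the limit.\<close>

lemma limsup_quality_geI:
  fixes t :: "nat \<Rightarrow> int list"
  assumes "inj t" "\<And>n. t n \<in> A" "\<And>n. f n \<le> quality (t n)" "f \<longlonglongrightarrow> c"
  shows "ereal c \<le> limsup_quality A"
  unfolding limsup_quality_def
proof (rule INF_greatest)
  fix S assume S: "S \<in> {S. S \<subseteq> A \<and> finite S}"
  then have "finite (t -` S)"
    using assms(1) by (auto intro: finite_vimageI)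
  then have "eventually (\<lambda>n. t n \<notin> S) sequentially"
    using eventually_cofinite[of "\<lambda>n. t n \<notin> S"] by (simp add: cofinite_eq_sequentially vimage_def)
  then have "eventually (\<lambda>n. ereal (f n) \<le> (SUP a\<in>A - S. ereal (quality a))) sequentially"
  proof eventually_elim
    case (elim n)
    then show ?case
      using assms(2,3)[of n] by (intro SUP_upper2[of "t n"]) auto
  qed
  moreover have "(\<lambda>n. ereal (f n)) \<longlonglongrightarrow> ereal c"
    using assms(4) by simp
  ultimately show "ereal c \<le> (SUP a\<in>A - S. ereal (quality a))"
    by (intro tendsto_upperbound) auto
qed

theorem theorem2p1:
  shows "limsup_quality (U_empty 5) \<ge> ereal (3 / 2)"
proof (rule limsup_quality_geI)
  let ?t = "\<lambda>n::nat. cubic_tuple (13 ^ (12 * n + 1))"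
  show "inj ?t"
    by (auto intro!: injI simp: cubic_tuple_def power_eq_iff_eq_base)
  show "?t n \<in> U_empty 5" for n
  proof (rule cubic_tuple_in_U_empty)
    \<comment> \<open>The exponent 12 is a common multiple of the orders of the unit groups modulo
      4, 3, 5 and 7, so \<open>13 ^ 12\<close> is 1 modulo 420.\<close>
    have "(13 ^ 12) ^ n mod 420 = (13 ^ 12 mod 420) ^ n mod (420 :: int)"
      by (rule power_mod[symmetric])
    then have "(13 ^ 12) ^ n mod 420 = (1 :: int)" by simp
    then have "13 * (13 ^ 12) ^ n mod 420 = (13 :: int)"
      using mod_mult_right_eq[of "13::int" "(13 ^ 12) ^ n" 420] by simp
    then show "13 ^ (12 * n + 1) mod 420 = (13 :: int)"
      by (simp add: power_mult)
    show "(13::int) \<le> 13 ^ (12 * n + 1)"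
      using self_le_power[of "13::int" "12 * n + 1"] by simp
  qed
  show "3 * real (12 * n + 1) * ln 13 / (2 * real (12 * n + 1) * ln 13 + ln 2730) \<le> quality (?t n)" for n
    by (rule quality_cubic_tuple_ge) simp
  show "(\<lambda>n. 3 * real (12 * n + 1) * ln 13 / (2 * real (12 * n + 1) * ln 13 + ln 2730)) \<longlonglongrightarrow> 3 / 2"
    by real_asymp
qed

end
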